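(* Let $E$ be a real normed linear space. If $\mathbb{A}$ is the global attractor of a homeomorphism $F:E\to E$, then $\mathbb{A}$ is strongly cellular in $E$.
   Context: A set $\mathbb{A}$ is a global attractor for a continuous map $F:E\to E$ if $\mathbb{A}$ is compact, $F(\mathbb{A})=\mathbb{A}$, and for every bounded $B\subset E$, $\operatorname{dist}(F^n(B),\mathbb{A})\to0$ as $n\to\infty$, where $\operatorname{dist}(A,B)=\sup_{a\in A}\inf_{b\in B}\|a-b\|$. A set $X\subset E$ is cellular in $E$ if $X=\bigcap_{j=1}^\infty C_j$, where the $C_j$ are cells, i.e. subsets of $E$ homeomorphic to the closed unit ball of $E$, with $C_{j+1}\subset\operatorname{int}(C_j)$ for all $j$. $X$ is strongly cellular if such a sequence $(C_j)$ can be chosen so that, in addition, for every open set $U$ containing $X$ there is a $j$ with $C_j\subset U$. *)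

theory Defs
  imports "HOL-Analysis.Analysis"
begin

(* Valued in ennreal: the supremum may be infinite (images of bounded sets need not be bounded
   when E is infinite dimensional), and inf {} = \<infinity>, sup {} = 0 as usual. In particular the
   empty set attracts no nonempty set, which would fail for infdist, since infdist x {} = 0. *)
definition semidist :: "'a::real_normed_vector set \<Rightarrow> 'a set \<Rightarrow> ennreal" where
  "semidist A B = (SUP a\<in>A. INF b\<in>B. ennreal (norm (a - b)))"

definition global_attractor :: "('a::real_normed_vector \<Rightarrow> 'a) \<Rightarrow> 'a set \<Rightarrow> bool" where
  "global_attractor F A \<longleftrightarrow>
     continuous_on UNIV F \<and> compact A \<and> F ` A = A \<and>
     (\<forall>B. bounded B \<longrightarrow> (\<lambda>n. semidist ((F ^^ n) ` B) A) \<longlonglongrightarrow> 0)"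

definition cell :: "'a::real_normed_vector set \<Rightarrow> bool" where
  "cell C \<longleftrightarrow> C homeomorphic (cball 0 1 :: 'a set)"

definition cell_sequence :: "(nat \<Rightarrow> 'a::real_normed_vector set) \<Rightarrow> 'a set \<Rightarrow> bool" where
  "cell_sequence C X \<longleftrightarrow>
     (\<forall>j. cell (C j)) \<and> (\<forall>j. C (Suc j) \<subseteq> interior (C j)) \<and> X = (\<Inter>j. C j)"

definition cellular :: "'a::real_normed_vector set \<Rightarrow> bool" where
  "cellular X \<longleftrightarrow> (\<exists>C. cell_sequence C X)"

definition strongly_cellular :: "'a::real_normed_vector set \<Rightarrow> bool" where
  "strongly_cellular X \<longleftrightarrow>
     (\<exists>C. cell_sequence C X \<and> (\<forall>U. open U \<and> X \<subseteq> U \<longrightarrow> (\<exists>j. C j \<subseteq> U)))"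

end

theory Submission
  imports Defs
begin

text \<open>
  If the ball \<open>B\<close> contains \<open>A\<close> in its interior, then attraction gives \<open>N \<ge> 1\<close> with
  \<open>F\<^sup>N(B) \<subseteq> int B\<close>, and the cells \<open>F\<^sup>j\<^sup>N(B)\<close> are nested, contain \<open>A\<close> by invariance, and
  shrink into every neighbourhood of \<open>A\<close> by attraction.
\<close>

lemma homeomorphism_funpow:
  fixes F :: "'a::topological_space \<Rightarrow> 'a"
  assumes "homeomorphism S S F G"
  shows "homeomorphism S S (F ^^ n) (G ^^ n)"
proof (induction n)
  case 0
  then show ?case by (auto simp: homeomorphism_def)
next
  case (Suc n)
  have "homeomorphism S S (F \<circ> F ^^ n) (G ^^ n \<circ> G)"
    using homeomorphism_compose[OF Suc assms] .
  then show ?case by (metis funpow.simps(2) funpow_Suc_right)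
qed

text \<open>A strict bound on the supremum bounds the infimum at each point of \<open>S\<close>
  strictly, so some point of \<open>A\<close> comes within \<open>e\<close>. For empty
  \<open>A\<close> the infimum is \<infinity>, which forces \<open>S\<close> to be empty.\<close>

lemma semidist_less_imp_subset:
  assumes "semidist S A < ennreal e"
  shows "S \<subseteq> (\<Union>a\<in>A. ball a e)"
proof
  fix x assume "x \<in> S"
  then have "(INF b\<in>A. ennreal (norm (x - b))) \<le> semidist S A"
    unfolding semidist_def by (rule SUP_upper)
  with assms have "(INF b\<in>A. ennreal (norm (x - b))) < ennreal e" by simp
  then obtain b where "b \<in> A" "ennreal (norm (x - b)) < ennreal e"
    by (auto simp: INF_less_iff)
  then show "x \<in> (\<Union>a\<in>A. ball a e)"
    by (auto simp: ennreal_less_iff dist_norm norm_minus_commute)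
qed

text \<open>Compactness of \<open>A\<close> fits a neighbourhood of uniform radius \<open>e\<close>
  inside \<open>U\<close>; attraction eventually brings the images of \<open>B\<close> within
  distance \<open>e\<close> of \<open>A\<close>.\<close>

lemma global_attractor_absorbs:
  assumes "global_attractor F A" "open U" "A \<subseteq> U" "bounded B"
  shows "\<forall>\<^sub>F n in sequentially. (F ^^ n) ` B \<subseteq> U"
proof -
  obtain e where "e > 0" and e: "(\<Union>a\<in>A. ball a e) \<subseteq> U"
    using compact_subset_open_imp_ball_epsilon_subset assms
    unfolding global_attractor_def by metis
  have "(\<lambda>n. semidist ((F ^^ n) ` B) A) \<longlonglongrightarrow> 0"
    using assms unfolding global_attractor_def by blast
  with \<open>e > 0\<close> have "\<forall>\<^sub>F n in sequentially. semidist ((F ^^ n) ` B) A < ennreal e"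
    by (auto intro: order_tendstoD)
  then show ?thesis
    by eventually_elim (use semidist_less_imp_subset e in blast)
qed

lemma cell_homeomorphism_image:
  fixes F :: "'a::real_normed_vector \<Rightarrow> 'a"
  assumes "homeomorphism UNIV UNIV F G" "r > 0"
  shows "cell (F ` cball x r)"
proof -
  have "cball x r homeomorphic F ` cball x r"
    using homeomorphism_of_subsets[OF assms(1)] unfolding homeomorphic_def by blast
  moreover have "cball x r homeomorphic (cball 0 1 :: 'a set)"
    using assms(2) by (simp add: homeomorphic_balls)
  ultimately show ?thesis
    unfolding cell_def using homeomorphic_sym homeomorphic_trans by blast
qed

theorem lemma2p2:
  fixes F :: "'a::real_normed_vector \<Rightarrow> 'a" and A :: "'a set"
  assumes "\<exists>G. homeomorphism UNIV UNIV F G"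
    and "global_attractor F A"
  shows "strongly_cellular A"
proof -
  obtain G where "homeomorphism UNIV UNIV F G" using assms(1) by blast
  then have hom: "homeomorphism UNIV UNIV (F ^^ n) (G ^^ n)" for n
    by (rule homeomorphism_funpow)
  have "compact A" and inv: "F ` A = A"
    using assms(2) unfolding global_attractor_def by auto
  have invn: "(F ^^ n) ` A = A" for n
    by (induction n, simp_all only: funpow.simps image_comp[symmetric] inv image_id, simp)
  obtain r where "r > 0" and r: "A \<subseteq> ball 0 r"
    using bounded_subset_ballD[OF compact_imp_bounded[OF \<open>compact A\<close>]] by blast
  have absorb: "\<forall>\<^sub>F n in sequentially. (F ^^ n) ` cball 0 r \<subseteq> U" if "open U" "A \<subseteq> U" for U
    using global_attractor_absorbs[OF assms(2) that bounded_cball] .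
  \<comment> \<open>Asking for \<open>N \<ge> 1\<close> ensures \<open>j * N \<ge> j\<close>, so the
    exponents \<open>j * N\<close> tend to infinity.\<close>
  obtain N where "N \<ge> 1" and N: "(F ^^ N) ` cball 0 r \<subseteq> ball 0 r"
    using eventually_conj[OF absorb[OF open_ball r] eventually_ge_at_top[of 1]]
    by (auto simp: eventually_sequentially)
  define C where "C j = (F ^^ (j * N)) ` cball 0 r" for j
  \<comment> \<open>Writing \<open>Suc j * N\<close> as \<open>j * N + N\<close> lets the absorption
    by \<open>F ^^ N\<close> act first; \<open>F ^^ (j * N)\<close> then carries it to the j-th
    cell.\<close>
  have step: "C (Suc j) \<subseteq> interior (C j)" for j
  proof -
    have "C (Suc j) = (F ^^ (j * N)) ` (F ^^ N) ` cball 0 r"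
      by (simp add: C_def image_comp add.commute[of N] funpow_add del: funpow.simps)
    also have "\<dots> \<subseteq> (F ^^ (j * N)) ` ball 0 r"
      using N by (rule image_mono)
    also have "\<dots> \<subseteq> interior (C j)"
    proof (rule interior_maximal)
      show "(F ^^ (j * N)) ` ball 0 r \<subseteq> C j"
        unfolding C_def by (intro image_mono ball_subset_cball)
      show "open ((F ^^ (j * N)) ` ball 0 r)"
        \<comment> \<open>The iterate is a homeomorphism onto the whole space, hence an open map in
          any dimension.\<close>
        using homeomorphism_imp_open_map[OF hom, of "ball 0 r"] by simp
    qed
    finally show ?thesis .
  qed
  have small: "\<exists>j. C j \<subseteq> U" if U: "open U" "A \<subseteq> U" for U
  proof -
    obtain M where M: "\<And>n. n \<ge> M \<Longrightarrow> (F ^^ n) ` cball 0 r \<subseteq> U"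
      using absorb[OF U] by (auto simp: eventually_sequentially)
    then show ?thesis
      \<comment> \<open>The index \<open>M\<close> itself works, because
        \<open>M * N \<ge> M\<close>.\<close>
      unfolding C_def using \<open>N \<ge> 1\<close> by (intro exI[of _ M] M) simp
  qed
  have "A = (\<Inter>j. C j)"
  proof
    have "A \<subseteq> C j" for j
      using image_mono[of A "cball 0 r" "F ^^ (j * N)"] r ball_subset_cball[of 0 r]
      unfolding C_def invn by blast
    then show "A \<subseteq> (\<Inter>j. C j)" by blast
    show "(\<Inter>j. C j) \<subseteq> A"
    proof
      fix x assume x: "x \<in> (\<Inter>j. C j)"
      show "x \<in> A"
      proof (rule ccontr)
        assume "x \<notin> A"
        \<comment> \<open>Points are closed, so the complement of \<open>x\<close> is an open
          neighbourhood of \<open>A\<close>, and some cell already misses \<open>x\<close>.\<close>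
        then have "\<exists>j. C j \<subseteq> - {x}" by (intro small) auto
        with x show False by blast
      qed
    qed
  qed
  moreover have "cell (C j)" for j
    unfolding C_def using hom \<open>r > 0\<close> by (rule cell_homeomorphism_image)
  ultimately have "cell_sequence C A"
    unfolding cell_sequence_def using step by blast
  then show ?thesis
    unfolding strongly_cellular_def using small by blast
qed

end
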